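(* Consider the problems $$(R):\ \min_{Z\in\mathbb R^{m\times n},\,\mathrm{rank}(Z)\le d}\tfrac12f(Z)+\lambda\,\mathrm{rank}(Z),\qquad (U):\ \min_{(X,Y)\in\mathbb R^{m\times d}\times\mathbb R^{n\times d}}f(XY^{\mathbb T})+\lambda(\mathrm{nnzc}(X)+\mathrm{nnzc}(Y)).$$ A matrix $\bar Z\in\mathbb R^{m\times n}$ is a local minimizer of $(R)$ if and only if it is a local minimizer of $f$ on $\{Z\in\mathbb R^{m\times n}:\mathrm{rank}(Z)\le d\}\cap\Omega_{\bar Z}$, where $\Omega_{\bar Z}:=\{Z\in\mathbb R^{m\times n}:\mathrm{rank}(Z)=\mathrm{rank}(\bar Z)\}$; this is also equivalent to $\bar Z$ being a local minimizer of $f$ on $\{Z\in\mathbb R^{m\times n}:\mathrm{rank}(Z)\le d\}\cap\{Z\in\mathbb R^{m\times n}:\mathrm{rank}(Z)\le\mathrm{rank}(\bar Z)\}$. Moreover, for any local minimizer $Z$ of $(R)$, there exists a local minimizer $(X,Y)$ of $(U)$ satisfying $XY^{\mathbb T}=Z$ and $\mathrm{nnzc}(X)=\mathrm{nnzc}(Y)=\mathrm{rank}(Z)$.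
   Context: Let $m\ge n\ge1$ and $d\ge1$ be integers, $\lambda>0$, and let $f:\mathbb R^{m\times n}\to\mathbb R$ be locally Lipschitz continuous. $\mathrm{nnzc}(C)$ denotes the number of nonzero columns of a matrix $C$. A local minimizer of a function on a set is by definition an element of that set (in particular a local minimizer of $(R)$ has rank at most $d$). *)

theory Defs
  imports "HOL-Analysis.Analysis"
begin

definition locally_lipschitz :: "('a::metric_space \<Rightarrow> 'b::metric_space) \<Rightarrow> bool"
  where "locally_lipschitz f \<longleftrightarrow> (\<forall>x. \<exists>u>0. \<exists>L. L-lipschitz_on (cball x u) f)"

(* The library notion carries an additional parameter, here a dummy one. *)
lemma locally_lipschitz_iff_local_lipschitz:
  "locally_lipschitz f \<longleftrightarrow> local_lipschitz (UNIV :: real set) UNIV (\<lambda>_. f)"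
proof
  assume "locally_lipschitz f"
  then show "local_lipschitz (UNIV :: real set) UNIV (\<lambda>_. f)"
    unfolding locally_lipschitz_def local_lipschitz_def Int_UNIV_right by blast
next
  assume *: "local_lipschitz (UNIV :: real set) UNIV (\<lambda>_. f)"
  show "locally_lipschitz f"
    unfolding locally_lipschitz_def
  proof
    fix x
    obtain u L where "u > 0" and "\<forall>t \<in> cball (0::real) u. L-lipschitz_on (cball x u) f"
      using * unfolding local_lipschitz_def Int_UNIV_right by blast
    moreover from this have "(0::real) \<in> cball 0 u"
      by simp
    ultimately show "\<exists>u>0. \<exists>L. L-lipschitz_on (cball x u) f"
      by blast
  qed
qed

definition nnzc :: "real ^ 'k ^ 'm \<Rightarrow> nat"
  where "nnzc C = card {j. column j C \<noteq> 0}"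

definition local_minimizer_on :: "('a::metric_space \<Rightarrow> real) \<Rightarrow> 'a set \<Rightarrow> 'a \<Rightarrow> bool"
  where "local_minimizer_on g S x \<longleftrightarrow>
    x \<in> S \<and> (\<exists>e>0. \<forall>y \<in> S \<inter> ball x e. g x \<le> g y)"

end

theory Submission
  imports Defs
begin

text \<open>
  Two facts carry the proof. First, rank and number of nonzero columns are lower semicontinuous
  and integer valued, so near a given point they either keep their value or grow by at least one.
  A penalty of this kind, multiplied by a positive constant and added to a continuous function
  \<open>g\<close>, therefore costs a fixed positive amount wherever it grows, more than \<open>g\<close> can decrease nearby:
  local minimality of the penalised function is local minimality of \<open>g\<close> where the penalty does not
  exceed its value at the point. This principle (\<open>local_minimizer_on_penalty_iff_le\<close>, with
  \<open>local_minimizer_on_le_iff_eq\<close>) gives both characterisations of the local minimizers of the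
  rank-penalised problem, and it applies to the factorised problem as well.

  Secondly, a matrix \<open>Z\<close> of rank \<open>r \<le> d\<close> factors as \<open>X Y\<^sup>T\<close> with exactly \<open>r\<close> nonzero columns
  in each factor (\<open>rank_factorization\<close>). If a nearby pair \<open>(X', Y')\<close> has at most \<open>2 r\<close> nonzero columns
  in total, lower semicontinuity forces exactly \<open>r\<close> in each factor, so \<open>X' Y'\<^sup>T\<close> has rank
  at most \<open>r\<close> and is close to \<open>Z\<close>; minimality of \<open>Z\<close> among such matrices gives minimality of \<open>(X, Y)\<close>.
\<close>

section \<open>Local minimizers of functions with an integer penalty\<close>

lemma local_minimizer_on_iff_eventually:
  "local_minimizer_on g S x \<longleftrightarrow> x \<in> S \<and> (\<forall>\<^sub>F y in nhds x. y \<in> S \<longrightarrow> g x \<le> g y)"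
  unfolding local_minimizer_on_def eventually_nhds_metric
  by (auto simp: dist_commute)

text \<open>
  Where the penalty exceeds its value at \<open>x\<close>, it exceeds it by at least one. Continuity confines the
  loss in \<open>g\<close> to less than \<open>c\<close>, so such points never beat \<open>x\<close>.
\<close>

lemma local_minimizer_on_penalty_iff_le:
  fixes g :: "'a::metric_space \<Rightarrow> real" and p :: "'a \<Rightarrow> nat"
  assumes "isCont g x" and "c > 0" and lsc: "\<forall>\<^sub>F y in nhds x. p x \<le> p y"
  shows "local_minimizer_on (\<lambda>y. g y + c * real (p y)) S x
    \<longleftrightarrow> local_minimizer_on g (S \<inter> {y. p y \<le> p x}) x"
proof -
  have "\<forall>\<^sub>F y in nhds x. g x - c < g y"
    using assms(1,2) unfolding isCont_def
    by (intro order_tendstoD(1)[where y = "g x"]) (auto simp: tendsto_at_iff_tendsto_nhds)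
  with lsc have "\<forall>\<^sub>F y in nhds x. (y \<in> S \<longrightarrow> g x + c * real (p x) \<le> g y + c * real (p y))
      \<longleftrightarrow> (y \<in> S \<inter> {y. p y \<le> p x} \<longrightarrow> g x \<le> g y)"
  proof eventually_elim
    case (elim y)
    show ?case
    proof (cases "p y = p x")
      case False
      with elim have "real (p x) + 1 \<le> real (p y)"
        by simp
      with \<open>c > 0\<close> have "c * (real (p x) + 1) \<le> c * real (p y)"
        by (intro mult_left_mono) auto
      with elim False show ?thesis
        by (auto simp: algebra_simps)
    qed simp
  qed
  then show ?thesis
    by (auto simp: local_minimizer_on_iff_eventually elim: eventually_elim2)
qed

lemma local_minimizer_on_le_iff_eq:
  fixes g :: "'a::metric_space \<Rightarrow> real" and p :: "'a \<Rightarrow> nat"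
  assumes lsc: "\<forall>\<^sub>F y in nhds x. p x \<le> p y"
  shows "local_minimizer_on g (S \<inter> {y. p y \<le> p x}) x
    \<longleftrightarrow> local_minimizer_on g (S \<inter> {y. p y = p x}) x"
  using lsc by (auto simp: local_minimizer_on_iff_eventually elim: eventually_elim2)

lemma local_minimizer_on_mult_left_iff:
  fixes g :: "'a::metric_space \<Rightarrow> real"
  assumes "c > 0"
  shows "local_minimizer_on (\<lambda>y. c * g y) S x \<longleftrightarrow> local_minimizer_on g S x"
  using assms by (simp add: local_minimizer_on_def)

lemma locally_lipschitz_imp_isCont:
  assumes "locally_lipschitz f"
  shows "isCont f x"
proof -
  obtain u L where "u > 0" and "L-lipschitz_on (cball x u) f"
    using assms unfolding locally_lipschitz_def by blast
  then have "continuous_on (ball x u) f"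
    using lipschitz_on_continuous_on continuous_on_subset ball_subset_cball by metis
  with \<open>u > 0\<close> show ?thesis
    by (simp add: continuous_on_eq_continuous_at)
qed


section \<open>Lower semicontinuity of rank and of the number of nonzero columns\<close>

lemma norm_matrix_vector_mult_le:
  fixes A :: "real ^ 'n ^ 'm"
  shows "norm (A *v x) \<le> norm A * norm x"
proof -
  have "norm (A *v x) \<le> L2_set (\<lambda>i. norm (A $ i) * norm x) UNIV"
    unfolding norm_vec_def[of "A *v x"]
    by (rule L2_set_mono)
       (auto simp: matrix_vector_mul_component norm_cauchy_schwarz Cauchy_Schwarz_ineq2)
  also have "\<dots> = norm A * norm x"
    by (simp add: norm_vec_def[of A] L2_set_left_distrib)
  finally show ?thesis .
qed

text \<open>
  The matrix \<open>A\<close> is injective on its row space, whose dimension is its rank, hence bounded below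
  there. Matrices close enough to \<open>A\<close> stay injective on that space, so their range is at least as
  large.
\<close>

lemma eventually_rank_ge:
  fixes A :: "real ^ 'n ^ 'm"
  shows "\<forall>\<^sub>F B in nhds A. rank A \<le> rank B"
proof -
  let ?S = "span (rows A)"
  obtain e where "e > 0" and e: "\<And>x. x \<in> ?S \<Longrightarrow> e * norm x \<le> norm (A *v x)"
    using injective_imp_isometric[of ?S "(*v) A"] nullspace_inter_rowspace[of A]
    by (auto simp: closed_subspace)
  have "rank A \<le> rank B" if "dist B A < e" for B :: "real ^ 'n ^ 'm"
  proof -
    have "x = 0" if "x \<in> ?S" and "B *v x = 0" for x
    proof (rule ccontr)
      assume "x \<noteq> 0"
      have "e * norm x \<le> norm (A *v x)"
        using e that by blast
      also have "\<dots> = norm ((B - A) *v x)"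
        using that by (simp add: matrix_vector_mult_diff_rdistrib)
      also have "\<dots> \<le> norm (B - A) * norm x"
        by (rule norm_matrix_vector_mult_le)
      also have "\<dots> < e * norm x"
        using \<open>dist B A < e\<close> \<open>x \<noteq> 0\<close> by (simp add: dist_norm)
      finally show False
        by simp
    qed
    then have "inj_on ((*v) B) ?S"
      by (subst linear_inj_on_iff_eq_0) auto
    then have "dim ((*v) B ` rows A) = dim (rows A)"
      by (intro dim_image_eq) auto
    moreover have "dim ((*v) B ` rows A) \<le> dim (range ((*v) B))"
      by (intro dim_subset) auto
    ultimately show ?thesis
      by (simp add: row_rank_def[of A] rank_dim_range[of B])
  qed
  with \<open>e > 0\<close> show ?thesis
    unfolding eventually_nhds_metric by blast
qed

lemma eventually_nnzc_ge:
  fixes X :: "real ^ 'k ^ 'm"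
  shows "\<forall>\<^sub>F X' in nhds X. nnzc X \<le> nnzc X'"
proof -
  have "\<forall>\<^sub>F X' in nhds X. column j X' \<noteq> 0" if "column j X \<noteq> 0" for j
  proof -
    have "((\<lambda>X'. column j X') \<longlongrightarrow> column j X) (nhds X)"
      unfolding column_def by (intro tendsto_vec_lambda tendsto_vec_nth filterlim_ident)
    with that show ?thesis
      using tendsto_imp_eventually_ne by blast
  qed
  then have "\<forall>\<^sub>F X' in nhds X. \<forall>j \<in> {j. column j X \<noteq> 0}. column j X' \<noteq> 0"
    by (intro eventually_ball_finite) auto
  then show ?thesis
    by eventually_elim (auto simp: nnzc_def intro!: card_mono)
qed


section \<open>Factorizations with few nonzero columns\<close>

lemma rank_le_nnzc:
  fixes X :: "real ^ 'k ^ 'm"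
  shows "rank X \<le> nnzc X"
proof -
  let ?J = "{j. column j X \<noteq> 0}"
  have "columns X \<subseteq> span ((\<lambda>j. column j X) ` ?J)"
  proof
    fix x
    assume "x \<in> columns X"
    then obtain j where "x = column j X"
      by (auto simp: columns_def)
    then show "x \<in> span ((\<lambda>j. column j X) ` ?J)"
      by (cases "x = 0") (auto simp: span_zero intro: span_base)
  qed
  then have "dim (columns X) \<le> card ((\<lambda>j. column j X) ` ?J)"
    by (intro dim_le_card) auto
  also have "\<dots> \<le> nnzc X"
    unfolding nnzc_def by (intro card_image_le) simp
  finally show ?thesis
    by (simp add: column_rank_def)
qed

text \<open>
  The nonzero columns of \<open>X\<close> form an orthonormal basis of the column space of \<open>Z\<close>, so that \<open>X X\<^sup>T\<close> is
  the orthogonal projection onto this space and \<open>X (Z\<^sup>T X)\<^sup>T = X X\<^sup>T Z = Z\<close>. A basis vector \<open>b\<close> is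
  not orthogonal to the columns of \<open>Z\<close>, so the corresponding column \<open>Z\<^sup>T b\<close> of \<open>Y = Z\<^sup>T X\<close> is nonzero.
\<close>

lemma rank_factorization:
  fixes Z :: "real ^ 'n ^ 'm"
  assumes "rank Z \<le> CARD('d)"
  obtains X :: "real ^ 'd ^ 'm" and Y :: "real ^ 'd ^ 'n"
  where "X ** transpose Y = Z" and "nnzc X = rank Z" and "nnzc Y = rank Z"
proof -
  let ?C = "span (columns Z)"
  obtain B where "B \<subseteq> ?C" and orth: "pairwise orthogonal B"
    and norm1: "\<And>x. x \<in> B \<Longrightarrow> norm x = 1" and "independent B"
    and "card B = dim ?C" and span: "span B = ?C"
    using orthonormal_basis_subspace[of ?C] by auto
  then have card: "card B = rank Z" and "finite B"
    by (auto simp: column_rank_def independent_imp_finite)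
  with assms obtain h :: "real ^ 'm \<Rightarrow> 'd" where h: "inj_on h B"
    using card_le_inj[of B "UNIV :: 'd set"] by auto
  define v where "v k = (if k \<in> h ` B then the_inv_into B h k else 0)" for k
  define X :: "real ^ 'd ^ 'm" where "X = (\<chi> i k. v k $ i)"
  define Y :: "real ^ 'd ^ 'n" where "Y = transpose Z ** X"
  have v_h: "v (h b) = b" if "b \<in> B" for b
    using that h by (simp add: v_def the_inv_into_f_f)
  have column_X: "column k X = v k" for k
    by (simp add: column_def X_def vec_eq_iff)
  have column_Y: "column k Y = transpose Z *v v k" for k
    by (simp add: Y_def X_def column_def matrix_matrix_mult_def matrix_vector_mult_def vec_eq_iff)
  have nz: "column k X \<noteq> 0 \<longleftrightarrow> k \<in> h ` B" for k
  proof (cases "k \<in> h ` B")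
    case True
    then obtain b where "b \<in> B" "k = h b"
      by blast
    with norm1[of b] v_h[of b] True show ?thesis
      by (auto simp: column_X)
  qed (simp add: column_X v_def)
  have nzY: "transpose Z *v b \<noteq> 0" if "b \<in> B" for b
  proof
    assume "transpose Z *v b = 0"
    moreover have "b \<in> span (rows (transpose Z))"
      using that \<open>B \<subseteq> ?C\<close> by auto
    ultimately have "b = 0"
      using nullspace_inter_rowspace by blast
    with norm1[OF that] show False
      by simp
  qed
  have "column k Y \<noteq> 0 \<longleftrightarrow> k \<in> h ` B" for k
  proof (cases "k \<in> h ` B")
    case True
    then obtain b where "b \<in> B" "k = h b"
      by blast
    with nzY[of b] v_h[of b] True show ?thesis
      by (simp add: column_Y)
  qed (simp add: column_Y v_def)
  with nz have "nnzc X = rank Z" "nnzc Y = rank Z"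
    using card card_image[OF h] by (simp_all add: nnzc_def)
  moreover have "X ** transpose Y = Z"
  proof -
    have "column j (X ** transpose Y) = column j Z" for j
    proof -
      let ?z = "column j Z"
      have "column j (X ** transpose Y) = (\<Sum>k\<in>UNIV. (?z \<bullet> v k) *\<^sub>R v k)"
        by (simp add: Y_def X_def column_def matrix_matrix_mult_def transpose_def vec_eq_iff
            inner_vec_def mult.commute)
      also have "\<dots> = (\<Sum>k\<in>h ` B. (?z \<bullet> v k) *\<^sub>R v k)"
        by (rule sum.mono_neutral_right) (auto simp: v_def)
      also have "\<dots> = (\<Sum>b\<in>B. (?z \<bullet> b) *\<^sub>R b)"
        using h v_h by (simp add: sum.reindex)
      also have "\<dots> = ?z"
        using orth norm1 \<open>finite B\<close>
        by (intro orthonormal_basis_expand) (auto simp: span columns_def intro: span_base)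
      finally show ?thesis .
    qed
    then show ?thesis
      by (simp add: column_def vec_eq_iff)
  qed
  ultimately show ?thesis
    using that by blast
qed

lemma isCont_mult_transpose:
  fixes P :: "(real ^ 'd ^ 'm) \<times> (real ^ 'd ^ 'n)"
  shows "isCont (\<lambda>(X, Y). X ** transpose Y) P"
  by (simp add: isCont_def case_prod_unfold matrix_matrix_mult_def transpose_def)
     (intro tendsto_vec_lambda tendsto_sum tendsto_mult tendsto_vec_nth tendsto_fst tendsto_snd
       tendsto_ident_at)


section \<open>The rank-penalised and the factorised problem\<close>

text \<open>
  By the penalty principle only nearby pairs with at most \<open>2 * rank Z\<close> nonzero columns in total
  compete with \<open>(X, Y)\<close>, and their products are admissible competitors of \<open>Z\<close> in the hypothesis.
\<close>

lemma local_minimizer_factorization: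
  fixes f :: "real ^ 'n ^ 'm \<Rightarrow> real" and X :: "real ^ 'd ^ 'm" and Y :: "real ^ 'd ^ 'n"
  assumes "isCont f Z" and "lam > 0"
    and min: "local_minimizer_on f ({W. rank W \<le> CARD('d)} \<inter> {W. rank W \<le> rank Z}) Z"
    and XY: "X ** transpose Y = Z" and "nnzc X = rank Z" and "nnzc Y = rank Z"
  shows "local_minimizer_on
    (\<lambda>(X, Y). f (X ** transpose Y) + lam * real (nnzc X + nnzc Y)) UNIV (X, Y)"
proof -
  define mul where "mul = (\<lambda>(X :: real ^ 'd ^ 'm, Y :: real ^ 'd ^ 'n). X ** transpose Y)"
  define p where "p = (\<lambda>(X :: real ^ 'd ^ 'm, Y :: real ^ 'd ^ 'n). nnzc X + nnzc Y)"
  have mul: "mul (X, Y) = Z" "isCont mul (X, Y)"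
    using XY isCont_mult_transpose by (simp_all add: mul_def)
  have "\<forall>\<^sub>F Q in nhds (X, Y). nnzc X \<le> nnzc (fst Q)"
    using tendsto_fst[OF filterlim_ident, of "(X, Y)"]
    by (intro eventually_compose_filterlim[OF eventually_nnzc_ge]) simp
  moreover have "\<forall>\<^sub>F Q in nhds (X, Y). nnzc Y \<le> nnzc (snd Q)"
    using tendsto_snd[OF filterlim_ident, of "(X, Y)"]
    by (intro eventually_compose_filterlim[OF eventually_nnzc_ge]) simp
  ultimately have lsc: "\<forall>\<^sub>F Q in nhds (X, Y). nnzc X \<le> nnzc (fst Q) \<and> nnzc Y \<le> nnzc (snd Q)"
    by eventually_elim simp
  have "\<forall>\<^sub>F W in nhds Z. rank W \<le> CARD('d) \<and> rank W \<le> rank Z \<longrightarrow> f Z \<le> f W"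
    using min by (simp add: local_minimizer_on_iff_eventually)
  moreover have "filterlim mul (nhds Z) (nhds (X, Y))"
    using mul tendsto_at_iff_tendsto_nhds[of mul "(X, Y)"] by (simp add: isCont_def)
  ultimately have "\<forall>\<^sub>F Q in nhds (X, Y).
      rank (mul Q) \<le> CARD('d) \<and> rank (mul Q) \<le> rank Z \<longrightarrow> f Z \<le> f (mul Q)"
    by (rule eventually_compose_filterlim)
  with lsc have "\<forall>\<^sub>F Q in nhds (X, Y). p Q \<le> p (X, Y) \<longrightarrow> f (mul (X, Y)) \<le> f (mul Q)"
  proof eventually_elim
    case (elim Q)
    show ?case
    proof
      assume "p Q \<le> p (X, Y)"
      \<comment> \<open>Neither factor can lose a nonzero column, so the bound on the total leaves neither one
          any to gain.\<close>
      with elim(1) have "nnzc (fst Q) = rank Z"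
        using assms(5,6) by (auto simp: p_def case_prod_unfold)
      then have "rank (mul Q) \<le> rank Z"
        using rank_mul_le_left[of "fst Q" "transpose (snd Q)"] rank_le_nnzc[of "fst Q"]
        by (simp add: mul_def case_prod_unfold)
      moreover have "rank Z \<le> CARD('d)"
        using min by (simp add: local_minimizer_on_def)
      ultimately show "f (mul (X, Y)) \<le> f (mul Q)"
        using elim(2) mul(1) by simp
    qed
  qed
  then have "local_minimizer_on (\<lambda>Q. f (mul Q)) (UNIV \<inter> {Q. p Q \<le> p (X, Y)}) (X, Y)"
    by (simp add: local_minimizer_on_iff_eventually)
  moreover have "isCont (\<lambda>Q. f (mul Q)) (X, Y)"
    using mul \<open>isCont f Z\<close> isCont_o2[of "(X, Y)" mul f] by simp
  moreover have "\<forall>\<^sub>F Q in nhds (X, Y). p (X, Y) \<le> p Q"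
    using lsc by eventually_elim (simp add: p_def case_prod_unfold)
  ultimately have "local_minimizer_on (\<lambda>Q. f (mul Q) + lam * real (p Q)) UNIV (X, Y)"
    using \<open>lam > 0\<close> by (simp add: local_minimizer_on_penalty_iff_le)
  then show ?thesis
    by (simp add: mul_def p_def case_prod_unfold)
qed

theorem proposition5:
  fixes f :: "real ^ 'n ^ 'm \<Rightarrow> real" and lam :: real
  assumes "CARD('n) \<le> CARD('m)"
    and "lam > 0"
    and "locally_lipschitz f"
  shows
    "(\<forall>Zbar :: real ^ 'n ^ 'm.
        (local_minimizer_on (\<lambda>Z. 1 / 2 * f Z + lam * real (rank Z)) {Z. rank Z \<le> CARD('d)} Zbar
          \<longleftrightarrow> local_minimizer_on f ({Z. rank Z \<le> CARD('d)} \<inter> {Z. rank Z = rank Zbar}) Zbar)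
      \<and> (local_minimizer_on (\<lambda>Z. 1 / 2 * f Z + lam * real (rank Z)) {Z. rank Z \<le> CARD('d)} Zbar
          \<longleftrightarrow> local_minimizer_on f ({Z. rank Z \<le> CARD('d)} \<inter> {Z. rank Z \<le> rank Zbar}) Zbar))
    \<and> (\<forall>Z :: real ^ 'n ^ 'm.
        local_minimizer_on (\<lambda>Z. 1 / 2 * f Z + lam * real (rank Z)) {Z. rank Z \<le> CARD('d)} Z
        \<longrightarrow> (\<exists>(X :: real ^ 'd ^ 'm) (Y :: real ^ 'd ^ 'n).
              local_minimizer_on
                (\<lambda>(X :: real ^ 'd ^ 'm, Y :: real ^ 'd ^ 'n).
                   f (X ** transpose Y) + lam * real (nnzc X + nnzc Y)) UNIV (X, Y)
            \<and> X ** transpose Y = Z \<and> nnzc X = rank Z \<and> nnzc Y = rank Z))"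
proof -
  have cont: "isCont f Z" for Z
    using assms(3) by (rule locally_lipschitz_imp_isCont)
  let ?D = "{Z :: real ^ 'n ^ 'm. rank Z \<le> CARD('d)}"
  let ?R = "\<lambda>Z. 1 / 2 * f Z + lam * real (rank Z)"
  have le: "local_minimizer_on ?R ?D Z
      \<longleftrightarrow> local_minimizer_on f (?D \<inter> {W. rank W \<le> rank Z}) Z" for Z
    using local_minimizer_on_penalty_iff_le[of Z "\<lambda>Z. 1 / 2 * f Z" lam rank ?D]
      local_minimizer_on_mult_left_iff[of "1 / 2" f] cont[of Z] \<open>lam > 0\<close> eventually_rank_ge[of Z]
    by simp
  have eq: "local_minimizer_on ?R ?D Z
      \<longleftrightarrow> local_minimizer_on f (?D \<inter> {W. rank W = rank Z}) Z" for Z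
    using le[of Z] local_minimizer_on_le_iff_eq[OF eventually_rank_ge, of f ?D Z] by simp
  have "\<exists>(X :: real ^ 'd ^ 'm) (Y :: real ^ 'd ^ 'n).
      local_minimizer_on (\<lambda>(X :: real ^ 'd ^ 'm, Y :: real ^ 'd ^ 'n).
        f (X ** transpose Y) + lam * real (nnzc X + nnzc Y)) UNIV (X, Y)
      \<and> X ** transpose Y = Z \<and> nnzc X = rank Z \<and> nnzc Y = rank Z"
    if "local_minimizer_on ?R ?D Z" for Z
  proof -
    have "rank Z \<le> CARD('d)"
      using that by (simp add: local_minimizer_on_def)
    then obtain X :: "real ^ 'd ^ 'm" and Y :: "real ^ 'd ^ 'n"
      where XY: "X ** transpose Y = Z" "nnzc X = rank Z" "nnzc Y = rank Z"
      by (rule rank_factorization)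
    then show ?thesis
      using local_minimizer_factorization[OF cont \<open>lam > 0\<close> _ XY] le[of Z] that by blast
  qed
  with le eq show ?thesis
    by blast
qed

end
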